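(* There exists an absolute constant $c>0$ such that for all positive integers $s \leq t$, $$\hat r(K_{s,t}) \geq c\, s^{2-\frac{s}{t}}\, t\, 2^s .$$
   Context: All graphs are finite and simple. $K_{s,t}$ denotes the complete bipartite graph with parts of sizes $s$ and $t$. A copy of $H$ in $G$ means a (not necessarily induced) subgraph of $G$ isomorphic to $H$. A graph $G$ is Ramsey for a graph $H$ if every two-coloring of the edges of $G$ contains a monochromatic copy of $H$. The size Ramsey number $\hat r(H)$ is the minimum number of edges in a graph $G$ which is Ramsey for $H$. *)

theory Defs
  imports Complex_Main "HOL-Library.Ramsey"
begin

type_synonym 'a graph = "'a set \<times> 'a set set"

abbreviation verts :: "'a graph \<Rightarrow> 'a set" where "verts G \<equiv> fst G"
abbreviation edges :: "'a graph \<Rightarrow> 'a set set" where "edges G \<equiv> snd G"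

definition fin_simple_graph :: "'a graph \<Rightarrow> bool" where
  "fin_simple_graph G \<longleftrightarrow> finite (verts G) \<and> edges G \<subseteq> [verts G]\<^bsup>2\<^esup>"

definition subgraph :: "'a graph \<Rightarrow> 'a graph \<Rightarrow> bool" where
  "subgraph H G \<longleftrightarrow>
     fin_simple_graph H \<and> fin_simple_graph G \<and> verts H \<subseteq> verts G \<and> edges H \<subseteq> edges G"

definition graph_iso :: "'a graph \<Rightarrow> 'b graph \<Rightarrow> bool" where
  "graph_iso G H \<longleftrightarrow>
     (\<exists>f. bij_betw f (verts G) (verts H) \<and>
          (\<forall>u\<in>verts G. \<forall>v\<in>verts G. {u, v} \<in> edges G \<longleftrightarrow> {f u, f v} \<in> edges H))"

definition is_copy_in :: "'a graph \<Rightarrow> 'b graph \<Rightarrow> 'a graph \<Rightarrow> bool" where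
  "is_copy_in K H G \<longleftrightarrow> subgraph K G \<and> graph_iso K H"

text \<open>A two-coloring is a total function on sets of vertices; only its values on the edges
  of \<open>G\<close> matter.\<close>

definition ramsey_for :: "'a graph \<Rightarrow> 'b graph \<Rightarrow> bool" where
  "ramsey_for G H \<longleftrightarrow>
     (\<forall>\<chi> :: 'a set \<Rightarrow> bool. \<exists>K. is_copy_in K H G \<and> (\<exists>b. \<forall>e\<in>edges K. \<chi> e = b))"

text \<open>Every finite graph is isomorphic to one with natural numbers as vertices, so letting
  \<open>G\<close> range over graphs of type \<^typ>\<open>nat graph\<close> loses no generality. By Ramsey's theorem the
  set of edge counts is nonempty for every finite simple \<open>H\<close>, so the least element is attained.\<close>

definition size_ramsey :: "'b graph \<Rightarrow> nat" where
  "size_ramsey H =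
     (LEAST m. \<exists>G :: nat graph. fin_simple_graph G \<and> ramsey_for G H \<and> card (edges G) = m)"

definition complete_bipartite :: "nat \<Rightarrow> nat \<Rightarrow> (nat + nat) graph" where
  "complete_bipartite s t =
     ({..<s} <+> {..<t}, {{Inl i, Inr j} | i j. i < s \<and> j < t})"

end

theory Submission
  imports Defs "HOL-Combinatorics.Multiset_Permutations"
begin

text \<open>Let \<open>G\<close> have \<open>m\<close> edges and call a vertex low if its degree is less than \<open>s\<^sup>2\<close>. Colour the
  edges from each low vertex to the vertices that are not low by a uniformly random colouring in
  which both colours occur equally often (up to one), independently for different low vertices,
  and colour all other edges by independent fair coins. Any \<open>k\<close> edges at a low vertex \<open>v\<close> in its
  balanced block are monochromatic with probability smaller than for fair coins by a factor
  \<open>exp (- k\<^sup>2 / O(deg v))\<close>, which for \<open>k = s\<close> is \<open>O(deg v / s\<^sup>2)\<close>.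

  A copy of \<open>K\<^bsub>s,t\<^esub>\<close> with low vertices on both sides lies between the neighbourhoods of two low
  vertices, so there are at most \<open>2 m\<close> times \<open>(s\<^sup>2 choose s) (s\<^sup>2 choose t)\<close> of these, and they are
  negligible. The remaining copies are bounded by weighting each vertex \<open>v\<close> of the \<open>t\<close>-side by
  \<open>min 1 (8 deg v / s\<^sup>2)\<close>: a copy contains a matching of \<open>s\<close> edges, and the choices
  for each of the other \<open>t - s\<close> vertices have total weight at most \<open>16 m / s\<^sup>2\<close>, so the expected
  number of monochromatic copies among them is at most \<open>2 (2 m)\<^sup>s (16 m / s\<^sup>2)\<^bsup>t - s\<^esup> / (s! t! 2\<^bsup>s t\<^esup>)\<close>.\<close>

subsection \<open>Balanced colourings\<close>

text \<open>Admitting both middle sizes when \<open>card B\<close> is odd makes the family closed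
  under complement and gives it \<open>(2 * r) choose r\<close> members in either parity, where
  \<open>r\<close> is half of \<open>card B\<close> rounded up.\<close>

definition balanced_subsets :: "'a set \<Rightarrow> 'a set set" where
  "balanced_subsets B = {R. R \<subseteq> B \<and> (card R = card B div 2 \<or> card R = (card B + 1) div 2)}"

lemma finite_balanced_subsets: "finite B \<Longrightarrow> finite (balanced_subsets B)"
  by (rule finite_subset[of _ "Pow B"]) (auto simp: balanced_subsets_def)

lemma card_balanced_subsets_disjoint:
  assumes "finite B" "F \<subseteq> B"
  defines "r \<equiv> (card B + 1) div 2"
  shows "card {R \<in> balanced_subsets B. F \<inter> R = {}} = (2 * r - card F) choose r"
proof -
  have fin: "finite (B - F)" and finF: "finite F" using assms finite_subset by auto
  have cBF: "card (B - F) = card B - card F" using assms finF by (simp add: card_Diff_subset)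
  have le: "card F \<le> card B" using assms by (simp add: card_mono)
  have eq: "{R \<in> balanced_subsets B. F \<inter> R = {}}
     = {R. R \<subseteq> B - F \<and> card R = card B div 2} \<union> {R. R \<subseteq> B - F \<and> card R = r}"
    by (auto simp: balanced_subsets_def r_def)
  show ?thesis
  proof (cases "even (card B)")
    case True
    then have "r = card B div 2" "2 * r = card B" by (auto simp: r_def)
    then show ?thesis unfolding eq using n_subsets[OF fin, of r] cBF by simp
  next
    case False
    then obtain q where q: "card B = 2 * q + 1" by (elim oddE)
    then have r: "r = Suc q" "card B div 2 = q" by (auto simp: r_def)
    have "card {R \<in> balanced_subsets B. F \<inter> R = {}}
        = card {R. R \<subseteq> B - F \<and> card R = q} + card {R. R \<subseteq> B - F \<and> card R = Suc q}"
      unfolding eq r by (rule card_Un_disjoint) (use fin in auto)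
    also have "\<dots> = Suc (card (B - F)) choose Suc q"
      using fin by (simp add: n_subsets)
    also have "Suc (card (B - F)) = 2 * r - card F" using le q r cBF by auto
    finally show ?thesis using r by simp
  qed
qed

text \<open>Complementation in \<open>B\<close> exchanges the two families, so a set of edges is as
  likely to be entirely red as entirely blue.\<close>

lemma card_balanced_subsets_superset:
  assumes "finite B" "F \<subseteq> B"
  shows "card {R \<in> balanced_subsets B. F \<subseteq> R} = card {R \<in> balanced_subsets B. F \<inter> R = {}}"
proof (rule bij_betw_same_card)
  have compl: "B - R \<in> balanced_subsets B" if "R \<in> balanced_subsets B" for R
  proof -
    have R: "R \<subseteq> B" using that by (simp add: balanced_subsets_def)
    then have "card (B - R) = card B - card R"
      using assms finite_subset by (metis card_Diff_subset)
    then show ?thesis using that R by (auto simp: balanced_subsets_def)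
  qed
  show "bij_betw (\<lambda>R. B - R) {R \<in> balanced_subsets B. F \<subseteq> R}
          {R \<in> balanced_subsets B. F \<inter> R = {}}"
    by (rule bij_betw_byWitness[where f' = "\<lambda>R. B - R"])
       (use assms compl in \<open>auto simp: balanced_subsets_def\<close>)
qed

text \<open>Lowering the upper index \<open>n = 2 * r - k\<close> by one multiplies the coefficient
  by \<open>(n - r) / n\<close>, which is at most \<open>(1/2) * exp (- k / (2 * r))\<close>. The
  exponents \<open>j / (2 * r)\<close> for \<open>j < k\<close> add up to
  \<open>k * (k - 1) / (4 * r)\<close>.\<close>

lemma central_binomial_decay:
  "k \<le> 2 * r \<Longrightarrow>
     real ((2 * r - k) choose r)
       \<le> (1/2) ^ k * exp (- (real k * (real k - 1) / (4 * real r))) * real ((2 * r) choose r)"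
proof (induction k)
  case 0
  then show ?case by simp
next
  case (Suc k)
  let ?n = "2 * r - k"
  have n: "0 < ?n" "real ?n = 2 * real r - real k" and r: "0 < r" using Suc.prems by auto
  have step: "real (?n - 1 choose r) \<le> real (?n choose r) * ((1/2) * exp (- (real k / (2 * real r))))"
  proof (cases "k \<le> r")
    case True
    have "real ?n * real (?n - 1 choose r) = real (?n - r) * real (?n choose r)"
      using binomial_absorb_comp[of ?n r] by (simp only: of_nat_mult[symmetric])
    then have eq: "real (?n - 1 choose r) = real (?n choose r) * ((real r - real k) / (2 * real r - real k))"
      using n True by (simp add: field_simps)
    \<comment> \<open>Clearing denominators turns this into
      \<open>0 \<le> k\<^sup>2\<close>.\<close>
    have "(real r - real k) / (2 * real r - real k) \<le> (1/2) * (1 - real k / (2 * real r))"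
      using n r True by (simp add: field_simps)
    moreover have "1 - real k / (2 * real r) \<le> exp (- (real k / (2 * real r)))"
      using exp_ge_add_one_self[of "- (real k / (2 * real r))"] by simp
    ultimately have "(real r - real k) / (2 * real r - real k) \<le> (1/2) * exp (- (real k / (2 * real r)))"
      using mult_left_mono[of "1 - real k / (2 * real r)" "exp (- (real k / (2 * real r)))" "1/2"]
      by (meson order.trans zero_le_divide_1_iff zero_le_numeral)
    then show ?thesis unfolding eq by (intro mult_left_mono) auto
  next
    case False
    then have "?n - 1 < r" using n by linarith
    then have "?n - 1 choose r = 0" by (rule binomial_eq_0)
    then have "real (?n - 1 choose r) = 0" by (simp only: of_nat_0)
    then show ?thesis
      by (simp only: mult_nonneg_nonneg of_nat_0_le_iff exp_ge_zero zero_le_divide_1_iff zero_le_numeral)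
  qed
  have "real ((2 * r - Suc k) choose r) = real (?n - 1 choose r)" by simp
  also have "\<dots> \<le> real (?n choose r) * ((1/2) * exp (- (real k / (2 * real r))))" by (rule step)
  also have "\<dots> \<le> ((1/2) ^ k * exp (- (real k * (real k - 1) / (4 * real r))) * real ((2 * r) choose r))
                 * ((1/2) * exp (- (real k / (2 * real r))))"
    using Suc.IH Suc.prems by (intro mult_right_mono) auto
  also have "\<dots> = (1/2) ^ Suc k
      * (exp (- (real k * (real k - 1) / (4 * real r))) * exp (- (real k / (2 * real r))))
      * real ((2 * r) choose r)" by simp
  also have "exp (- (real k * (real k - 1) / (4 * real r))) * exp (- (real k / (2 * real r)))
     = exp (- (real (Suc k) * (real (Suc k) - 1) / (4 * real r)))"
    unfolding exp_add[symmetric] using r by (simp add: field_simps)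
  finally show ?case .
qed

lemma balanced_subsets_disjoint_bound:
  assumes "finite B" "F \<subseteq> B"
  shows "real (card {R \<in> balanced_subsets B. F \<inter> R = {}})
       \<le> (1/2) ^ card F * exp (- (real (card F) * (real (card F) - 1) / (2 * (real (card B) + 1))))
           * real (card (balanced_subsets B))"
proof -
  define r k where "r = (card B + 1) div 2" and "k = card F"
  have k: "k \<le> card B" using assms by (simp add: k_def card_mono)
  have r: "card B \<le> 2 * r" "2 * r \<le> card B + 1" by (auto simp: r_def)
  have all: "card (balanced_subsets B) = (2 * r) choose r"
    using card_balanced_subsets_disjoint[OF assms(1), of "{}"] by (simp add: r_def)
  \<comment> \<open>The denominators compare by \<open>2 * r \<le> card B + 1\<close>. The case
    \<open>k = 0\<close> is separate because \<open>real k - 1\<close> is then negative.\<close>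
  have "real k * (real k - 1) / (2 * (real (card B) + 1)) \<le> real k * (real k - 1) / (4 * real r)"
  proof (cases "k = 0")
    case False
    have "2 * real r \<le> real (card B) + 1" using r(2) by linarith
    then show ?thesis using False k r by (intro divide_left_mono mult_nonneg_nonneg mult_pos_pos) auto
  qed simp
  then have "exp (- (real k * (real k - 1) / (4 * real r)))
      \<le> exp (- (real k * (real k - 1) / (2 * (real (card B) + 1))))" by simp
  then have "(1/2) ^ k * exp (- (real k * (real k - 1) / (4 * real r))) * real ((2 * r) choose r)
      \<le> (1/2) ^ k * exp (- (real k * (real k - 1) / (2 * (real (card B) + 1)))) * real ((2 * r) choose r)"
    by (intro mult_right_mono mult_left_mono) auto
  moreover have "real (card {R \<in> balanced_subsets B. F \<inter> R = {}})
      \<le> (1/2) ^ k * exp (- (real k * (real k - 1) / (4 * real r))) * real ((2 * r) choose r)"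
    using central_binomial_decay[of k r] k r card_balanced_subsets_disjoint[OF assms]
    by (simp add: k_def r_def)
  ultimately show ?thesis unfolding all k_def[symmetric] by (rule order.trans[rotated])
qed

lemma card_balanced_subsets_pos: "finite B \<Longrightarrow> 0 < card (balanced_subsets B)"
  using card_balanced_subsets_disjoint[of B "{}"] by (simp add: zero_less_binomial_iff)

text \<open>Bounds the probability that all of \<open>F\<close> receives one given colour when every fibre of \<open>\<beta>\<close>
  in \<open>E\<close> is coloured independently by a uniformly random balanced subset.\<close>

definition mono_bound :: "'e set \<Rightarrow> ('e \<Rightarrow> 'b) \<Rightarrow> 'e set \<Rightarrow> real" where
  "mono_bound E \<beta> F = (1/2) ^ card F *
     (\<Prod>b\<in>\<beta> ` E. exp (- (real (card {e\<in>F. \<beta> e = b}) * (real (card {e\<in>F. \<beta> e = b}) - 1)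
        / (2 * (real (card {e\<in>E. \<beta> e = b}) + 1)))))"

text \<open>A union bound in counting form: \<open>\<Omega>\<close> consists of all choices of a
  balanced red set in every block. If no choice worked, the bad events would cover
  \<open>\<Omega>\<close>, although their sizes sum to less than \<open>card \<Omega>\<close>. The
  factor 2 stands for the two colours.\<close>

lemma balanced_colouring_exists:
  assumes "finite E" "finite I" "\<And>i. i \<in> I \<Longrightarrow> F i \<subseteq> E"
    and sum: "2 * (\<Sum>i\<in>I. mono_bound E \<beta> (F i)) < 1"
  shows "\<exists>\<chi> :: 'e \<Rightarrow> bool. \<forall>i\<in>I. \<not> (\<exists>b. \<forall>e\<in>F i. \<chi> e = b)"
proof -
  define blk where "blk = (\<lambda>b. {e\<in>E. \<beta> e = b})"
  define \<Omega> where "\<Omega> = (\<Pi>\<^sub>E b\<in>\<beta> ` E. balanced_subsets (blk b))"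
  define red where "red = (\<lambda>A. {\<omega>\<in>\<Omega>. \<forall>e\<in>A. e \<in> \<omega> (\<beta> e)})"
  define blue where "blue = (\<lambda>A. {\<omega>\<in>\<Omega>. \<forall>e\<in>A. e \<notin> \<omega> (\<beta> e)})"
  have fblk: "finite (blk b)" for b using assms(1) by (simp add: blk_def)
  have fin\<Omega>: "finite \<Omega>" unfolding \<Omega>_def using assms(1) fblk
    by (intro finite_PiE) (auto intro: finite_balanced_subsets)
  have card\<Omega>: "card \<Omega> = (\<Prod>b\<in>\<beta> ` E. card (balanced_subsets (blk b)))"
    unfolding \<Omega>_def using assms(1) by (simp add: card_PiE)
  have pos: "0 < card \<Omega>" unfolding card\<Omega> using card_balanced_subsets_pos[OF fblk] by (simp add: prod_pos)
  \<comment> \<open>Independence of the blocks: each of the two events is contained in a product of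
    one condition per block, so the bounds for single blocks multiply.\<close>
  have key: "real (card (red A)) \<le> mono_bound E \<beta> A * real (card \<Omega>)
           \<and> real (card (blue A)) \<le> mono_bound E \<beta> A * real (card \<Omega>)" if A: "A \<subseteq> E" for A
  proof -
    define Ab where "Ab = (\<lambda>b. {e\<in>A. \<beta> e = b})"
    have finA: "finite A" using A assms(1) finite_subset by auto
    have Ab: "Ab b \<subseteq> blk b" for b using A by (auto simp: Ab_def blk_def)
    have sumA: "(\<Sum>b\<in>\<beta> ` E. card (Ab b)) = card A"
    proof -
      have "A = (\<Union>b\<in>\<beta> ` E. Ab b)" using A by (auto simp: Ab_def)
      moreover have "card (\<Union>b\<in>\<beta> ` E. Ab b) = (\<Sum>b\<in>\<beta> ` E. card (Ab b))"
        using assms(1) finA by (intro card_UN_disjoint) (auto simp: Ab_def)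
      ultimately show ?thesis by simp
    qed
    have "red A \<subseteq> (\<Pi>\<^sub>E b\<in>\<beta> ` E. {R \<in> balanced_subsets (blk b). Ab b \<subseteq> R})"
    proof
      fix \<omega> assume "\<omega> \<in> red A"
      then have "\<omega> \<in> \<Omega>" "Ab b \<subseteq> \<omega> b" for b by (auto simp: red_def Ab_def)
      then show "\<omega> \<in> (\<Pi>\<^sub>E b\<in>\<beta> ` E. {R \<in> balanced_subsets (blk b). Ab b \<subseteq> R})"
        by (auto simp: \<Omega>_def PiE_iff)
    qed
    moreover have "blue A \<subseteq> (\<Pi>\<^sub>E b\<in>\<beta> ` E. {R \<in> balanced_subsets (blk b). Ab b \<inter> R = {}})"
    proof
      fix \<omega> assume "\<omega> \<in> blue A"
      then have "\<omega> \<in> \<Omega>" "Ab b \<inter> \<omega> b = {}" for b by (auto simp: blue_def Ab_def)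
      then show "\<omega> \<in> (\<Pi>\<^sub>E b\<in>\<beta> ` E. {R \<in> balanced_subsets (blk b). Ab b \<inter> R = {}})"
        by (auto simp: \<Omega>_def PiE_iff)
    qed
    moreover have "finite (\<Pi>\<^sub>E b\<in>\<beta> ` E. {R \<in> balanced_subsets (blk b). P b R})" for P
      using assms(1) fblk by (auto intro!: finite_PiE simp: finite_balanced_subsets)
    ultimately have "card (red A) \<le> card (\<Pi>\<^sub>E b\<in>\<beta> ` E. {R \<in> balanced_subsets (blk b). Ab b \<subseteq> R})"
      and "card (blue A) \<le> card (\<Pi>\<^sub>E b\<in>\<beta> ` E. {R \<in> balanced_subsets (blk b). Ab b \<inter> R = {}})"
      by (simp_all only: card_mono)
    then have "card (red A) \<le> (\<Prod>b\<in>\<beta> ` E. card {R \<in> balanced_subsets (blk b). Ab b \<subseteq> R})"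
      and "card (blue A) \<le> (\<Prod>b\<in>\<beta> ` E. card {R \<in> balanced_subsets (blk b). Ab b \<inter> R = {}})"
      using assms(1) by (simp_all add: card_PiE)
    moreover have "(\<Prod>b\<in>\<beta> ` E. card {R \<in> balanced_subsets (blk b). Ab b \<subseteq> R})
       = (\<Prod>b\<in>\<beta> ` E. card {R \<in> balanced_subsets (blk b). Ab b \<inter> R = {}})"
      using card_balanced_subsets_superset[OF fblk Ab] by simp
    moreover have "real (\<Prod>b\<in>\<beta> ` E. card {R \<in> balanced_subsets (blk b). Ab b \<inter> R = {}})
       \<le> mono_bound E \<beta> A * real (card \<Omega>)"
    proof -
      have "real (\<Prod>b\<in>\<beta> ` E. card {R \<in> balanced_subsets (blk b). Ab b \<inter> R = {}})
        \<le> (\<Prod>b\<in>\<beta> ` E. (1/2) ^ card (Ab b)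
            * exp (- (real (card (Ab b)) * (real (card (Ab b)) - 1) / (2 * (real (card (blk b)) + 1))))
            * real (card (balanced_subsets (blk b))))"
        unfolding of_nat_prod
        by (intro prod_mono conjI balanced_subsets_disjoint_bound[OF fblk Ab]) simp
      also have "\<dots> = mono_bound E \<beta> A * real (card \<Omega>)"
        unfolding prod.distrib power_sum[symmetric] sumA card\<Omega> mono_bound_def
        by (simp add: Ab_def blk_def)
      finally show ?thesis .
    qed
    ultimately show ?thesis by (simp only: of_nat_le_iff[symmetric, where 'a = real]) linarith
  qed
  have "\<exists>\<omega>\<in>\<Omega>. \<omega> \<notin> (\<Union>i\<in>I. red (F i) \<union> blue (F i))"
  proof (rule ccontr)
    assume "\<not> ?thesis"
    then have "\<Omega> \<subseteq> (\<Union>i\<in>I. red (F i) \<union> blue (F i))" by auto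
    moreover have "finite (\<Union>i\<in>I. red (F i) \<union> blue (F i))"
      using assms(2) fin\<Omega> by (auto simp: red_def blue_def)
    ultimately have "card \<Omega> \<le> card (\<Union>i\<in>I. red (F i) \<union> blue (F i))" by (simp add: card_mono)
    also have "\<dots> \<le> (\<Sum>i\<in>I. card (red (F i) \<union> blue (F i)))" by (rule card_UN_le[OF assms(2)])
    also have "\<dots> \<le> (\<Sum>i\<in>I. card (red (F i)) + card (blue (F i)))"
      by (intro sum_mono card_Un_le)
    finally have "real (card \<Omega>) \<le> real (\<Sum>i\<in>I. card (red (F i)) + card (blue (F i)))"
      using of_nat_le_iff by blast
    also have "\<dots> \<le> (\<Sum>i\<in>I. 2 * mono_bound E \<beta> (F i) * real (card \<Omega>))"
      unfolding of_nat_sum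
    proof (rule sum_mono)
      fix i assume "i \<in> I"
      from key[OF assms(3)[OF this]]
      show "real (card (red (F i)) + card (blue (F i))) \<le> 2 * mono_bound E \<beta> (F i) * real (card \<Omega>)"
        by simp
    qed
    also have "\<dots> = (2 * (\<Sum>i\<in>I. mono_bound E \<beta> (F i))) * real (card \<Omega>)"
      by (simp add: sum_distrib_left sum_distrib_right mult.assoc)
    also have "\<dots> < 1 * real (card \<Omega>)" using sum pos by (intro mult_strict_right_mono) auto
    finally show False by simp
  qed
  then obtain \<omega> where \<omega>: "\<omega> \<in> \<Omega>" "\<forall>i\<in>I. \<omega> \<notin> red (F i) \<and> \<omega> \<notin> blue (F i)" by auto
  show ?thesis
  proof (intro exI[of _ "\<lambda>e. e \<in> \<omega> (\<beta> e)"] ballI notI, elim exE)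
    fix i b assume "i \<in> I" "\<forall>e\<in>F i. (e \<in> \<omega> (\<beta> e)) = b"
    then show False using \<omega> by (cases b) (auto simp: red_def blue_def)
  qed
qed

subsection \<open>Counting weighted bicliques\<close>

lemma sum_lists_prod:
  fixes w :: "'a \<Rightarrow> real"
  assumes "finite A"
  shows "(\<Sum>xs | set xs \<subseteq> A \<and> length xs = n. \<Prod>x\<leftarrow>xs. w x) = (\<Sum>x\<in>A. w x) ^ n"
proof (induction n)
  case 0
  have "{xs. set xs \<subseteq> A \<and> length xs = 0} = {[]}" by auto
  then show ?case by simp
next
  case (Suc n)
  let ?L = "{xs. set xs \<subseteq> A \<and> length xs = n}"
  have eq: "{xs. set xs \<subseteq> A \<and> length xs = Suc n} = (\<lambda>(x, xs). x # xs) ` (A \<times> ?L)"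
    by (auto simp: length_Suc_conv image_iff)
  have "(\<Sum>xs | set xs \<subseteq> A \<and> length xs = Suc n. \<Prod>x\<leftarrow>xs. w x) = (\<Sum>(x, xs)\<in>A \<times> ?L. w x * (\<Prod>x\<leftarrow>xs. w x))"
    unfolding eq by (subst sum.reindex) (auto simp: inj_on_def case_prod_unfold)
  also have "\<dots> = (\<Sum>x\<in>A. w x) * (\<Sum>xs\<in>?L. \<Prod>x\<leftarrow>xs. w x)"
    by (simp add: sum_product sum.cartesian_product)
  finally show ?case using Suc.IH by simp
qed

text \<open>Each pair \<open>(S, T)\<close> is counted once for every ordering of \<open>S\<close> and of \<open>T\<close>: pairing the
  \<open>i\<close>-th element of \<open>S\<close> with the \<open>i\<close>-th element of \<open>T\<close> gives \<open>s\<close> elements of \<open>A\<close>, and the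
  remaining \<open>t - s\<close> elements of \<open>T\<close> are arbitrary vertices.\<close>

lemma weighted_bipartite_count:
  fixes w :: "'a \<Rightarrow> real"
  assumes "finite V" "s \<le> t" and w: "\<And>v. 0 \<le> w v" "\<And>v. w v \<le> 1"
    and A: "A \<subseteq> V \<times> V"
    and K: "\<And>S T. (S, T) \<in> \<K> \<Longrightarrow> S \<times> T \<subseteq> A \<and> finite S \<and> T \<subseteq> V \<and> card S = s \<and> card T = t"
  shows "fact s * fact t * (\<Sum>(S, T)\<in>\<K>. \<Prod>v\<in>T. w v) \<le> real (card A) ^ s * (\<Sum>v\<in>V. w v) ^ (t - s)"
proof (cases "finite \<K>")
  case True
  define P where "P = (SIGMA (S, T):\<K>. permutations_of_set S \<times> permutations_of_set T)"
  define L1 where "L1 = {ps. set ps \<subseteq> A \<and> length ps = s}"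
  define L2 where "L2 = {ys. set ys \<subseteq> V \<and> length ys = t - s}"
  define \<phi> where "\<phi> = (\<lambda>(_ :: 'a set \<times> 'a set, xs :: 'a list, ys :: 'a list). (zip xs (take s ys), drop s ys))"
  have finA: "finite A" using A assms(1) finite_subset by blast
  have finT: "finite T" if "(S, T) \<in> \<K>" for S T using K[OF that] assms(1) finite_subset by blast
  have len: "length xs = s" "length ys = t" "set xs = S" "set ys = T" "distinct ys"
    if "((S, T), xs, ys) \<in> P" for S T xs ys
    using that K[of S T] finT[of S T]
    by (auto simp: P_def permutations_of_set_def distinct_card[symmetric])
  have finL: "finite L1" "finite L2"
    using finA assms(1) by (auto simp: L1_def L2_def intro: finite_lists_length_eq)
  have "fact s * fact t * (\<Sum>(S, T)\<in>\<K>. \<Prod>v\<in>T. w v)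
      = (\<Sum>(S, T)\<in>\<K>. \<Sum>(xs, ys)\<in>permutations_of_set S \<times> permutations_of_set T. \<Prod>v\<in>T. w v)"
    unfolding sum_distrib_left
    by (rule sum.cong) (use K finT in \<open>auto simp: card_cartesian_product\<close>)
  also have "\<dots> = (\<Sum>((S, T), xs, ys)\<in>P. \<Prod>v\<in>T. w v)"
    unfolding P_def using True K finT
    by (subst sum.Sigma[symmetric]) (auto simp: case_prod_unfold)
  also have "\<dots> = (\<Sum>((S, T), xs, ys)\<in>P. \<Prod>y\<leftarrow>ys. w y)"
  proof (rule sum.cong[OF refl], clarify)
    fix S T xs ys assume "((S, T), xs, ys) \<in> P"
    then show "(\<Prod>v\<in>T. w v) = (\<Prod>y\<leftarrow>ys. w y)"
      using len[of S T xs ys] prod.distinct_set_conv_list[of ys w] by auto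
  qed
  also have "\<dots> \<le> (\<Sum>p\<in>P. (\<lambda>(ps, zs). \<Prod>z\<leftarrow>zs. w z) (\<phi> p))"
  proof (rule sum_mono, clarify)
    fix S T xs ys
    \<comment> \<open>The weights of the \<open>s\<close> matched vertices are bounded by 1; only
      those of the last \<open>t - s\<close> vertices are kept.\<close>
    have "(\<Prod>y\<leftarrow>zs. w y) \<le> 1" for zs
      using w by (induction zs) (auto intro!: mult_le_one prod_list_nonneg)
    moreover have "0 \<le> (\<Prod>y\<leftarrow>zs. w y)" for zs using w by (intro prod_list_nonneg) auto
    moreover have "(\<Prod>y\<leftarrow>ys. w y) = (\<Prod>y\<leftarrow>take s ys. w y) * (\<Prod>y\<leftarrow>drop s ys. w y)"
      by (metis append_take_drop_id map_append prod_list.append)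
    ultimately show "(\<Prod>y\<leftarrow>ys. w y) \<le> (case \<phi> ((S, T), xs, ys) of (ps, zs) \<Rightarrow> \<Prod>z\<leftarrow>zs. w z)"
      by (simp add: \<phi>_def mult_left_le_one_le)
  qed
  also have "\<dots> = (\<Sum>(ps, zs)\<in>\<phi> ` P. \<Prod>z\<leftarrow>zs. w z)"
  proof (rule sum.reindex_cong[symmetric, of \<phi>])
    \<comment> \<open>Both lists in the zip have length \<open>s\<close>, so the zip determines them
      and the dropped part completes \<open>ys\<close>. Then \<open>S\<close> and \<open>T\<close>
      are the sets of entries of \<open>xs\<close> and \<open>ys\<close>.\<close>
    show "inj_on \<phi> P"
    proof (rule inj_onI)
      fix p q assume p: "p \<in> P" "q \<in> P" "\<phi> p = \<phi> q"
      obtain S T xs ys S' T' xs' ys' where pq: "p = ((S, T), xs, ys)" "q = ((S', T'), xs', ys')"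
        by (metis surj_pair)
      then have 1: "((S, T), xs, ys) \<in> P" and 2: "((S', T'), xs', ys') \<in> P"
        and eq: "\<phi> ((S, T), xs, ys) = \<phi> ((S', T'), xs', ys')" using p by simp_all
      note l = len[OF 1] len[OF 2]
      have "zip xs (take s ys) = zip xs' (take s ys')" "drop s ys = drop s ys'"
        using eq by (auto simp: \<phi>_def)
      moreover from this(1) have "map fst (zip xs (take s ys)) = map fst (zip xs' (take s ys'))"
        "map snd (zip xs (take s ys)) = map snd (zip xs' (take s ys'))" by simp_all
      moreover from this have "xs = xs'" "take s ys = take s ys'"
        using l assms(2) by simp_all
      ultimately have "xs = xs'" "ys = ys'" by (metis append_take_drop_id)+
      then show "p = q" using l unfolding pq by auto
    qed
  qed auto
  also have "\<dots> \<le> (\<Sum>(ps, zs)\<in>L1 \<times> L2. \<Prod>z\<leftarrow>zs. w z)"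
  proof (rule sum_mono2)
    show "\<phi> ` P \<subseteq> L1 \<times> L2"
    proof (rule image_subsetI, clarify)
      fix S T xs ys assume 1: "((S, T), xs, ys) \<in> P"
      then have "S \<times> T \<subseteq> A" "T \<subseteq> V" using K[of S T] by (simp_all add: P_def)
      moreover have "set (zip xs (take s ys)) \<subseteq> S \<times> T"
        using len[OF 1] by (auto dest: set_zip_leftD set_zip_rightD in_set_takeD)
      moreover have "set (drop s ys) \<subseteq> T" using len[OF 1] set_drop_subset by fast
      ultimately show "\<phi> ((S, T), xs, ys) \<in> L1 \<times> L2"
        using len[OF 1] assms(2) by (simp add: \<phi>_def L1_def L2_def subset_trans)
    qed
  qed (use finL w in \<open>auto intro!: prod_list_nonneg\<close>)
  also have "\<dots> = real (card L1) * (\<Sum>zs\<in>L2. \<Prod>z\<leftarrow>zs. w z)"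
    by (simp add: sum.cartesian_product[symmetric])
  also have "\<dots> = real (card A) ^ s * (\<Sum>v\<in>V. w v) ^ (t - s)"
    using finA assms(1) by (simp add: L1_def L2_def card_lists_length_eq sum_lists_prod)
  finally show ?thesis .
\<comment> \<open>For infinite \<open>\<K>\<close> the sum is 0 by convention.\<close>
qed (use w in \<open>simp add: sum_nonneg\<close>)

subsection \<open>Bicliques in a graph\<close>

text \<open>Every factor of \<open>mono_bound\<close> is at most 1, so blocks outside
  \<open>C\<close> may be dropped; inside \<open>C\<close> a factor decreases with the number of
  edges of \<open>F\<close> in the block and increases with the block size. For
  \<open>C = {}\<close> this is the bound for fair coins.\<close>

lemma mono_bound_le:
  assumes "finite E" "C \<subseteq> \<beta> ` E"
    and k: "\<And>b. b \<in> C \<Longrightarrow> s \<le> card {e\<in>F. \<beta> e = b}"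
    and d: "\<And>b. b \<in> C \<Longrightarrow> card {e\<in>E. \<beta> e = b} \<le> D b"
  shows "mono_bound E \<beta> F
    \<le> (1/2) ^ card F * (\<Prod>b\<in>C. exp (- (real s * (real s - 1) / (2 * (real (D b) + 1)))))"
proof -
  define f where "f = (\<lambda>b. exp (- (real (card {e\<in>F. \<beta> e = b}) * (real (card {e\<in>F. \<beta> e = b}) - 1)
        / (2 * (real (card {e\<in>E. \<beta> e = b}) + 1)))))"
  have nonneg: "0 \<le> real n * (real n - 1)" for n :: nat by (cases n) auto
  have f: "0 \<le> f b" "f b \<le> 1" for b using nonneg by (auto simp: f_def)
  have "(\<Prod>b\<in>\<beta> ` E. f b) = (\<Prod>b\<in>\<beta> ` E - C. f b) * (\<Prod>b\<in>C. f b)"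
    using assms(1,2) by (intro prod.subset_diff) auto
  also have "\<dots> \<le> 1 * (\<Prod>b\<in>C. f b)"
    using f by (intro mult_right_mono prod_le_1 prod_nonneg) auto
  also have "(\<Prod>b\<in>C. f b) \<le> (\<Prod>b\<in>C. exp (- (real s * (real s - 1) / (2 * (real (D b) + 1)))))"
  proof (intro prod_mono conjI f)
    fix b assume b: "b \<in> C"
    have "real s * (real s - 1) \<le> real (card {e\<in>F. \<beta> e = b}) * (real (card {e\<in>F. \<beta> e = b}) - 1)"
    proof (cases "s = 0")
      case False
      then show ?thesis using k[OF b] by (intro mult_mono) auto
    qed (use nonneg in simp)
    then show "f b \<le> exp (- (real s * (real s - 1) / (2 * (real (D b) + 1))))"
      unfolding f_def using d[OF b] nonneg by (simp add: frac_le)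
  qed
  finally show ?thesis unfolding mono_bound_def f_def by (simp add: mult_left_mono)
qed

definition neighbours :: "'a set set \<Rightarrow> 'a \<Rightarrow> 'a set" where
  "neighbours E v = {u. {u, v} \<in> E}"

definition arcs :: "'a set set \<Rightarrow> ('a \<times> 'a) set" where
  "arcs E = {(x, y). {x, y} \<in> E}"

text \<open>Edges inside \<open>S\<close> or inside \<open>T\<close> are allowed, in accordance with
  copies that are not necessarily induced.\<close>

definition bicliques :: "'a set set \<Rightarrow> nat \<Rightarrow> nat \<Rightarrow> ('a set \<times> 'a set) set" where
  "bicliques E s t = {(S, T). finite S \<and> finite T \<and> card S = s \<and> card T = t \<and> S \<times> T \<subseteq> arcs E}"

definition edges_between :: "'a set \<Rightarrow> 'a set \<Rightarrow> 'a set set" where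
  "edges_between S T = (\<lambda>(x, y). {x, y}) ` (S \<times> T)"

lemma edges_between_subset: "(S, T) \<in> bicliques E s t \<Longrightarrow> edges_between S T \<subseteq> E"
  by (auto simp: bicliques_def edges_between_def arcs_def)

text \<open>The blocks of the balanced colouring: the edges joining a vertex \<open>v \<in> L\<close> to the complement
  of \<open>L\<close> form the block \<open>{v}\<close>, and every other edge is a block by itself.\<close>

definition edge_block :: "'a set \<Rightarrow> 'a set \<Rightarrow> 'a set" where
  "edge_block L e = (if card (e \<inter> L) = 1 then e \<inter> L else e)"

context
  fixes V :: "'a set" and E :: "'a set set"
  assumes finite_V: "finite V" and E: "E \<subseteq> [V]\<^bsup>2\<^esup>"
begin

section \<open>Arcs, degrees and the edge sets of bicliques\<close>

lemma arcsD: "(x, y) \<in> arcs E \<Longrightarrow> x \<in> V \<and> y \<in> V \<and> x \<noteq> y"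
  using subsetD[OF E, of "{x, y}"]
  unfolding arcs_def by simp

lemma arcs_subset: "arcs E \<subseteq> V \<times> V"
  using arcsD by auto

lemma finite_E: "finite E"
  using finite_V E finite_imp_finite_nsets finite_subset by blast

lemma finite_arcs: "finite (arcs E)"
  using arcs_subset finite_V finite_subset by blast

lemma finite_neighbours: "finite (neighbours E v)"
  using arcs_subset finite_subset[OF _ finite_V, of "neighbours E v"]
  by (auto simp: arcs_def neighbours_def)

lemma card_arcs_le: "card (arcs E) \<le> 2 * card E"
proof -
  have "arcs E = (\<Union>e\<in>E. {(x, y). {x, y} = e})" by (auto simp: arcs_def)
  also have "card \<dots> \<le> (\<Sum>e\<in>E. card {(x, y). {x, y} = e})" by (rule card_UN_le[OF finite_E])
  also have "\<dots> \<le> (\<Sum>e\<in>E. 2)"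
  proof (rule sum_mono)
    fix e assume "e \<in> E"
    then obtain a b where "e = {a, b}" using E nsets2_E by (metis subsetD)
    then have "{(x, y). {x, y} = e} \<subseteq> {(a, b), (b, a)}" by (auto simp: doubleton_eq_iff)
    then have "card {(x, y). {x, y} = e} \<le> card {(a, b), (b, a)}" by (intro card_mono) auto
    also have "\<dots> \<le> 2" using card_length[of "[(a, b), (b, a)]"] by simp
    finally show "card {(x, y). {x, y} = e} \<le> 2" .
  qed
  finally show ?thesis by simp
qed

text \<open>The handshake lemma: every arc is counted at its second vertex.\<close>

lemma sum_degrees: "(\<Sum>v\<in>V. card (neighbours E v)) = card (arcs E)"
proof -
  have "card (SIGMA v:V. neighbours E v) = card (arcs E)"
    using arcs_subset
    by (intro bij_betw_same_card[of prod.swap] bij_betw_byWitness[where f' = prod.swap])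
       (auto simp: arcs_def neighbours_def)
  then show ?thesis using finite_V finite_neighbours by simp
qed

lemma bicliques_subset:
  assumes "(S, T) \<in> bicliques E s t" "1 \<le> s" "1 \<le> t"
  shows "S \<subseteq> V" "T \<subseteq> V" "S \<inter> T = {}"
proof -
  have "S \<noteq> {}" "T \<noteq> {}" "S \<times> T \<subseteq> arcs E" using assms by (auto simp: bicliques_def)
  then show "S \<subseteq> V" "T \<subseteq> V" "S \<inter> T = {}" using arcsD by blast+
qed

lemma card_edges_between:
  assumes "(S, T) \<in> bicliques E s t" "1 \<le> s" "1 \<le> t"
  shows "card (edges_between S T) = s * t"
proof -
  have "inj_on (\<lambda>(x, y). {x, y}) (S \<times> T)"
    using bicliques_subset(3)[OF assms] by (auto simp: inj_on_def doubleton_eq_iff)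
  then show ?thesis using assms(1)
    by (simp add: edges_between_def card_image card_cartesian_product bicliques_def)
qed

text \<open>An edge is never a singleton, so its block can be \<open>{v}\<close> only as its
  intersection with \<open>L\<close>; hence the edge contains \<open>v\<close>.\<close>

lemma card_edge_block_le: "card {e\<in>E. edge_block L e = {v}} \<le> card (neighbours E v)"
proof -
  have "{e\<in>E. edge_block L e = {v}} \<subseteq> (\<lambda>u. {u, v}) ` neighbours E v"
  proof
    fix e assume "e \<in> {e\<in>E. edge_block L e = {v}}"
    then have e: "e \<in> E" "edge_block L e = {v}" by auto
    obtain a b where ab: "e = {a, b}" "a \<noteq> b" using e(1) E nsets2_E by (metis subsetD)
    then have "v \<in> e" using e(2) by (auto simp: edge_block_def split: if_splits)
    then have "e = {a, v} \<or> e = {b, v}" using ab by auto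
    then show "e \<in> (\<lambda>u. {u, v}) ` neighbours E v" using e(1) by (auto simp: neighbours_def)
  qed
  then have "card {e\<in>E. edge_block L e = {v}} \<le> card ((\<lambda>u. {u, v}) ` neighbours E v)"
    using finite_neighbours by (intro card_mono) auto
  also have "\<dots> \<le> card (neighbours E v)" using finite_neighbours by (rule card_image_le)
  finally show ?thesis .
qed

text \<open>If \<open>T\<close> meets \<open>L\<close>, then \<open>S\<close> avoids
  \<open>L\<close>, so all \<open>s\<close> edges from a vertex \<open>v\<close> of
  \<open>T \<inter> L\<close> to \<open>S\<close> lie in the balanced block \<open>{v}\<close>,
  which has at most as many edges as the degree of \<open>v\<close>. This saves the factor bounded
  by the weight of \<open>v\<close>. Vertices outside \<open>L\<close> have weight 1 and need no
  saving.\<close>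

lemma mono_bound_edges_between_le:
  assumes ST: "(S, T) \<in> bicliques E s t" and s: "2 \<le> s" "1 \<le> t"
    and L: "L = {v. card (neighbours E v) < s\<^sup>2}" and disj: "S \<inter> L = {} \<or> T \<inter> L = {}"
  shows "mono_bound E (edge_block L) (edges_between S T)
    \<le> (1/2) ^ (s * t) * (\<Prod>v\<in>T. min 1 (8 * real (card (neighbours E v)) / (real s)\<^sup>2))"
proof -
  define w where "w = (\<lambda>v. min 1 (8 * real (card (neighbours E v)) / (real s)\<^sup>2))"
  have s1: "1 \<le> s" using s by simp
  have finT: "finite T" and cS: "card S = s" and arc: "S \<times> T \<subseteq> arcs E" and neS: "S \<noteq> {}"
    using ST s by (auto simp: bicliques_def)
  have w1: "w v = 1" if "v \<notin> L" for v
  proof -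
    have "real (s\<^sup>2) \<le> real (card (neighbours E v))" using that unfolding L of_nat_le_iff by simp
    then have "(real s)\<^sup>2 \<le> 8 * real (card (neighbours E v))" unfolding of_nat_power by linarith
    then have "1 \<le> 8 * real (card (neighbours E v)) / (real s)\<^sup>2" using s by (simp add: le_divide_eq)
    then show ?thesis by (simp add: w_def)
  qed
  then have prod_w: "(\<Prod>v\<in>T. w v) = (\<Prod>v\<in>T \<inter> L. w v)"
    using finT by (intro prod.mono_neutral_right) auto
  have "mono_bound E (edge_block L) (edges_between S T) \<le> (1/2) ^ card (edges_between S T) *
      (\<Prod>b\<in>(\<lambda>v. {v}) ` (T \<inter> L). exp (- (real s * (real s - 1) / (2 * (real (card (neighbours E (the_elem b))) + 1)))))"
  proof (rule mono_bound_le[OF finite_E])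
    have blk: "edge_block L {x, v} = {v}" if "x \<in> S" "v \<in> T \<inter> L" for x v
    proof -
      have "{x, v} \<inter> L = {v}" using that disj by auto
      then show ?thesis by (simp add: edge_block_def)
    qed
    show "(\<lambda>v. {v}) ` (T \<inter> L) \<subseteq> edge_block L ` E"
    proof clarify
      fix v assume v: "v \<in> T" "v \<in> L"
      obtain x where "x \<in> S" using neS by auto
      then have "{x, v} \<in> E" "edge_block L {x, v} = {v}" using v arc blk by (auto simp: arcs_def)
      then show "{v} \<in> edge_block L ` E" by (metis imageI)
    qed
    fix b assume "b \<in> (\<lambda>v. {v}) ` (T \<inter> L)"
    then obtain v where v: "b = {v}" "v \<in> T \<inter> L" by auto
    show "card {e\<in>E. edge_block L e = b} \<le> card (neighbours E (the_elem b))"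
      using card_edge_block_le v by simp
    have "(\<lambda>x. {x, v}) ` S \<subseteq> {e\<in>edges_between S T. edge_block L e = b}"
      using v blk by (auto simp: edges_between_def)
    moreover have "finite (edges_between S T)"
      using edges_between_subset[OF ST] finite_E finite_subset by blast
    ultimately have "card ((\<lambda>x. {x, v}) ` S) \<le> card {e\<in>edges_between S T. edge_block L e = b}"
      by (intro card_mono) auto
    moreover have "card ((\<lambda>x. {x, v}) ` S) = s"
      unfolding cS[symmetric] by (rule card_image) (auto simp: inj_on_def doubleton_eq_iff)
    ultimately show "s \<le> card {e\<in>edges_between S T. edge_block L e = b}" by simp
  qed
  also have "\<dots> = (1/2) ^ (s * t) *
      (\<Prod>v\<in>T \<inter> L. exp (- (real s * (real s - 1) / (2 * (real (card (neighbours E v)) + 1)))))"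
    using card_edges_between[OF ST s1 s(2)] by (subst prod.reindex) auto
  also have "\<dots> \<le> (1/2) ^ (s * t) * (\<Prod>v\<in>T \<inter> L. w v)"
  proof (intro mult_left_mono prod_mono conjI)
    fix v assume "v \<in> T \<inter> L"
    then obtain x where "x \<in> S" "x \<in> neighbours E v" using neS arc by (auto simp: arcs_def neighbours_def)
    then have d: "1 \<le> card (neighbours E v)" using finite_neighbours[of v] by (simp add: Suc_le_eq card_gt_0_iff) auto
    define d where "d = real (card (neighbours E v))"
    define x where "x = real s * (real s - 1) / (2 * (d + 1))"
    have d1: "1 \<le> d" using d by (simp add: d_def)
    \<comment> \<open>The constant 8 comes from \<open>s - 1 \<ge> s / 2\<close> and
      \<open>2 * (d + 1) \<le> 4 * d\<close>, valid for \<open>s \<ge> 2\<close> and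
      \<open>d \<ge> 1\<close>. The saving is then read off from
      \<open>exp x \<ge> x\<close>.\<close>
    have "(real s)\<^sup>2 / (8 * d) = (real s * (real s / 2)) / (4 * d)" by (simp add: power2_eq_square)
    also have "\<dots> \<le> x" unfolding x_def using s d1 by (intro frac_le mult_left_mono) auto
    finally have x: "(real s)\<^sup>2 / (8 * d) \<le> x" .
    have pos: "0 < (real s)\<^sup>2 / (8 * d)" using s d1 by simp
    have "exp (- x) = 1 / exp x" by (simp add: exp_minus divide_inverse)
    also have "\<dots> \<le> 1 / ((real s)\<^sup>2 / (8 * d))"
    proof (rule divide_left_mono)
      show "(real s)\<^sup>2 / (8 * d) \<le> exp x" using x exp_ge_add_one_self[of x] by linarith
    qed (use mult_pos_pos[OF exp_gt_zero[of x] pos] in simp_all)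
    also have "\<dots> = 8 * d / (real s)\<^sup>2" by simp
    finally have "exp (- x) \<le> w v" using x pos by (simp add: w_def d_def)
    then show "exp (- (real s * (real s - 1) / (2 * (real (card (neighbours E v)) + 1)))) \<le> w v"
      by (simp add: x_def d_def)
  qed auto
  finally show ?thesis unfolding prod_w[symmetric] by (simp only: w_def)
qed

text \<open>Pick low vertices \<open>x\<close> in \<open>S\<close> and \<open>y\<close> in
  \<open>T\<close>. They form an arc, and \<open>S\<close> and \<open>T\<close> are contained in the
  neighbourhoods of \<open>y\<close> and \<open>x\<close>, each of fewer than
  \<open>s\<^sup>2\<close> vertices.\<close>

lemma card_low_bicliques_le:
  assumes L: "L = {v. card (neighbours E v) < s\<^sup>2}"
  shows "card {(S, T)\<in>bicliques E s t. S \<inter> L \<noteq> {} \<and> T \<inter> L \<noteq> {}}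
     \<le> card (arcs E) * ((s\<^sup>2 choose s) * (s\<^sup>2 choose t))"
proof -
  define Q where "Q = (\<lambda>(x, y). {S. S \<subseteq> neighbours E y \<and> card S = s} \<times> {T. T \<subseteq> neighbours E x \<and> card T = t})"
  have finQ: "finite (Q p)" for p
    using finite_neighbours by (auto simp: Q_def case_prod_unfold)
  have "{(S, T)\<in>bicliques E s t. S \<inter> L \<noteq> {} \<and> T \<inter> L \<noteq> {}} \<subseteq> (\<Union>p\<in>arcs E \<inter> L \<times> L. Q p)"
  proof (rule subsetI)
    fix p assume "p \<in> {(S, T)\<in>bicliques E s t. S \<inter> L \<noteq> {} \<and> T \<inter> L \<noteq> {}}"
    then obtain S T x y where p: "p = (S, T)"
      and "(S, T) \<in> bicliques E s t" "x \<in> S" "x \<in> L" "y \<in> T" "y \<in> L" by blast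
    then have "(x, y) \<in> arcs E \<inter> L \<times> L" "(S, T) \<in> Q (x, y)"
      by (auto simp: bicliques_def Q_def arcs_def neighbours_def insert_commute)
    then show "p \<in> (\<Union>p\<in>arcs E \<inter> L \<times> L. Q p)" unfolding p by (rule UN_I)
  qed
  then have "card {(S, T)\<in>bicliques E s t. S \<inter> L \<noteq> {} \<and> T \<inter> L \<noteq> {}} \<le> card (\<Union>p\<in>arcs E \<inter> L \<times> L. Q p)"
    using finite_arcs finQ by (intro card_mono) auto
  also have "\<dots> \<le> (\<Sum>p\<in>arcs E \<inter> L \<times> L. card (Q p))"
    using finite_arcs by (intro card_UN_le) auto
  also have "\<dots> \<le> (\<Sum>p\<in>arcs E \<inter> L \<times> L. (s\<^sup>2 choose s) * (s\<^sup>2 choose t))"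
  proof (rule sum_mono, clarify)
    fix x y assume "x \<in> L" "y \<in> L"
    then have "card (neighbours E x) \<le> s\<^sup>2" "card (neighbours E y) \<le> s\<^sup>2" using L by auto
    then show "card (Q (x, y)) \<le> (s\<^sup>2 choose s) * (s\<^sup>2 choose t)"
      using finite_neighbours
      by (simp add: Q_def card_cartesian_product n_subsets mult_le_mono binomial_right_mono)
  qed
  also have "\<dots> \<le> card (arcs E) * ((s\<^sup>2 choose s) * (s\<^sup>2 choose t))"
    using finite_arcs by (simp add: card_mono)
  finally show ?thesis .
qed

end

subsection \<open>Copies of complete bipartite graphs\<close>

lemma bicliques_mono: "E \<subseteq> E' \<Longrightarrow> bicliques E s t \<subseteq> bicliques E' s t"
  by (auto simp: bicliques_def arcs_def)

lemma copy_of_complete_bipartite: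
  assumes "is_copy_in K (complete_bipartite s t) G"
  shows "\<exists>S T. (S, T) \<in> bicliques (edges K) s t"
proof -
  obtain f where f: "bij_betw f (verts K) ({..<s} <+> {..<t})"
    and iso: "\<And>u v. u \<in> verts K \<Longrightarrow> v \<in> verts K \<Longrightarrow>
        {u, v} \<in> edges K \<longleftrightarrow> {f u, f v} \<in> edges (complete_bipartite s t)"
    using assms by (auto simp: is_copy_in_def graph_iso_def complete_bipartite_def)
  define g where "g = inv_into (verts K) f"
  have g: "bij_betw g ({..<s} <+> {..<t}) (verts K)"
    using f bij_betw_inv_into unfolding g_def by blast
  have fg: "f (g z) = z" if "z \<in> {..<s} <+> {..<t}" for z
    using f that unfolding g_def by (rule bij_betw_inv_into_right)
  have gV: "g z \<in> verts K" if "z \<in> {..<s} <+> {..<t}" for z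
    using g that by (auto dest: bij_betwE)
  have inj: "inj_on g ({..<s} <+> {..<t})" using g by (rule bij_betw_imp_inj_on)
  define S T where "S = (\<lambda>i. g (Inl i)) ` {..<s}" and "T = (\<lambda>j. g (Inr j)) ` {..<t}"
  have "card S = s" "card T = t"
    unfolding S_def T_def by (subst card_image; use inj in \<open>force simp: inj_on_def\<close>)+
  moreover have "S \<times> T \<subseteq> arcs (edges K)"
  proof
    fix p assume "p \<in> S \<times> T"
    then obtain i j where p: "p = (g (Inl i), g (Inr j))" "i < s" "j < t"
      by (auto simp: S_def T_def)
    have z: "Inl i \<in> {..<s} <+> {..<t}" "Inr j \<in> {..<s} <+> {..<t}" using p by auto
    have "{Inl i, Inr j} \<in> edges (complete_bipartite s t)"
      using p by (auto simp: complete_bipartite_def)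
    then have "{g (Inl i), g (Inr j)} \<in> edges K"
      using iso[OF gV[OF z(1)] gV[OF z(2)]] by (simp only: fg[OF z(1)] fg[OF z(2)])
    then show "p \<in> arcs (edges K)" by (simp add: p arcs_def)
  qed
  ultimately have "(S, T) \<in> bicliques (edges K) s t"
    by (simp add: bicliques_def) (simp add: S_def T_def)
  then show ?thesis by blast
qed

lemma complete_bipartite_edgeD: "{a, b} \<in> edges (complete_bipartite s t) \<Longrightarrow> a \<noteq> b"
  by (auto simp: complete_bipartite_def doubleton_eq_iff)

text \<open>Guarantees that the \<open>LEAST\<close> in \<open>size_ramsey\<close> is attained.
  Ramsey's theorem gives a complete graph with a monochromatic clique on \<open>s + t\<close>
  vertices, and any bijection from the clique to the vertices of the bipartite graph pulls back a
  copy.\<close>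

lemma ramsey_graph_exists:
  "\<exists>G :: nat graph. fin_simple_graph G \<and> ramsey_for G (complete_bipartite s t)"
proof -
  obtain N :: nat where N: "partn_lst {..<N} [s + t, s + t] 2" using ramsey_full by blast
  define G :: "nat graph" where "G = ({..<N}, [{..<N}]\<^bsup>2\<^esup>)"
  have G: "fin_simple_graph G" by (simp add: fin_simple_graph_def G_def)
  let ?B = "complete_bipartite s t"
  have "\<exists>K. is_copy_in K ?B G \<and> (\<exists>b. \<forall>e\<in>edges K. \<chi> e = b)" for \<chi> :: "nat set \<Rightarrow> bool"
  proof -
    define f where "f = (\<lambda>e. if \<chi> e then 1 else 0 :: nat)"
    have "f \<in> nsets {..<N} 2 \<rightarrow> {..<length [s + t, s + t]}" by (auto simp: f_def)
    then obtain i H where i: "i < length [s + t, s + t]"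
      and H: "H \<in> nsets {..<N} ([s + t, s + t] ! i)" "f ` nsets H 2 \<subseteq> {i}"
      using partn_lstE[OF N _ refl] by metis
    have "[s + t, s + t] ! i = s + t" using i by (auto simp: less_Suc_eq)
    then have H': "H \<subseteq> {..<N}" "finite H" "card H = s + t" using H(1) by (auto simp: nsets_def)
    obtain h where h: "bij_betw h H ({..<s} <+> {..<t})"
      using finite_same_card_bij[of H "{..<s} <+> {..<t}"] H' by (auto simp: card_Plus)
    define K where "K = (H, {{u, v} | u v. u \<in> H \<and> v \<in> H \<and> {h u, h v} \<in> edges ?B})"
    have KH: "edges K \<subseteq> [H]\<^bsup>2\<^esup>"
      unfolding K_def using complete_bipartite_edgeD by fastforce
    have "fin_simple_graph K" using KH H' by (simp add: fin_simple_graph_def K_def)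
    then have "subgraph K G" using G KH H' nsets_mono[of H "{..<N}" 2]
      by (auto simp: subgraph_def K_def G_def)
    moreover have "graph_iso K ?B"
      unfolding graph_iso_def
    proof (intro exI[of _ h] conjI ballI)
      show "bij_betw h (verts K) (verts ?B)" using h by (simp add: K_def complete_bipartite_def)
      fix u v assume uv: "u \<in> verts K" "v \<in> verts K"
      show "{u, v} \<in> edges K \<longleftrightarrow> {h u, h v} \<in> edges ?B"
      proof
        assume "{u, v} \<in> edges K"
        then obtain a b where ab: "{u, v} = {a, b}" "{h a, h b} \<in> edges ?B" by (auto simp: K_def)
        have "{h u, h v} = h ` {u, v}" by simp
        also have "\<dots> = {h a, h b}" unfolding ab(1) by simp
        finally show "{h u, h v} \<in> edges ?B" using ab(2) by simp
      qed (use uv in \<open>auto simp: K_def\<close>)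
    qed
    moreover have "\<chi> e = (i = 1)" if "e \<in> edges K" for e
    proof -
      have "f e = i" using that KH H(2) by blast
      then show ?thesis by (auto simp: f_def split: if_splits)
    qed
    ultimately show ?thesis unfolding is_copy_in_def by blast
  qed
  then show ?thesis using G unfolding ramsey_for_def by blast
qed

subsection \<open>Estimates\<close>

text \<open>\<open>n ^ n / fact n\<close> is one term of the exponential series of \<open>n\<close>,
  and \<open>exp 1 \<le> 3\<close>.\<close>

lemma power_self_le_fact: "real n ^ n \<le> 3 ^ n * fact n"
proof -
  have "exp (real n) = exp 1 ^ n" by (simp add: exp_of_nat_mult[of n 1, simplified])
  also have "\<dots> \<le> 3 ^ n" using exp_le by (intro power_mono) auto
  finally have "exp (real n) \<le> 3 ^ n" .
  moreover have "real n ^ n / fact n \<le> exp (real n)"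
  proof -
    have "(\<Sum>k\<in>{n}. real n ^ k /\<^sub>R fact k) \<le> (\<Sum>k. real n ^ k /\<^sub>R fact k)"
      by (rule sum_le_suminf[OF summable_exp_generic]) auto
    then show ?thesis by (simp add: exp_def field_simps)
  qed
  ultimately have "real n ^ n / fact n \<le> 3 ^ n" by (rule order.trans[rotated])
  then show ?thesis by (simp add: divide_le_eq)
qed

text \<open>The constant is 8 * 3 * 3: the count of low bicliques leads to the base
  \<open>8 * (3 * s)\<^sup>2 / 2 ^ s\<close>, which has to be at most 1.\<close>

lemma square_le_exp: "16 \<le> n \<Longrightarrow> 72 * n\<^sup>2 \<le> (2::nat) ^ n"
proof (induction n rule: nat_induct_at_least)
  case (Suc n)
  have "16 * n \<le> n * n" and "(Suc n)\<^sup>2 = n * n + 2 * n + 1"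
    using Suc(1) by (simp_all add: power2_eq_square)
  then have "72 * (Suc n)\<^sup>2 \<le> 2 * (72 * n\<^sup>2)" using Suc(1) unfolding power2_eq_square by linarith
  with Suc.IH show ?case by simp
qed simp

lemma cube_le_exp: "2 \<le> n \<Longrightarrow> n ^ 3 \<le> (4::nat) ^ n"
proof (induction n rule: nat_induct_at_least)
  case (Suc n)
  have "(Suc n) ^ 3 = n ^ 3 + 3 * n\<^sup>2 + 3 * n + 1"
    by (simp add: power3_eq_cube power2_eq_square algebra_simps)
  moreover have "2 * n\<^sup>2 \<le> n ^ 3" "2 * n \<le> n\<^sup>2"
    using Suc(1) by (simp_all add: power3_eq_cube power2_eq_square)
  ultimately have "(Suc n) ^ 3 \<le> 4 * n ^ 3" using Suc(1) by linarith
  with Suc.IH show ?case by simp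
qed simp

text \<open>This estimate dictates the exponent \<open>2 - s / t\<close>: raised to the power
  \<open>t\<close>, the bound on \<open>M\<close> contributes \<open>s ^ (2 * (t - s))\<close>,
  which cancels the denominators of the weights, and \<open>s ^ s * t ^ t\<close>, which is compared
  with the factorials. The powers of 2 cancel, leaving \<open>(144 * c) ^ t\<close> with 144 = 16 *
  3 * 3.\<close>

lemma weighted_count_estimate:
  assumes "1 \<le> s" "s \<le> t" and M: "0 \<le> M" "M \<le> (1/2)^24 * real s powr (2 - real s / real t) * real t * 2 ^ s"
  shows "(1/2) ^ (s * t) * ((2 * M) ^ s * (16 * M / (real s)\<^sup>2) ^ (t - s)) / (fact s * fact t) \<le> 1/8"
proof -
  define c :: real where "c = (1/2)^24"
  have s: "0 < real s" "0 < real t" using assms by auto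
  have "M ^ t \<le> (c * real s powr (2 - real s / real t) * real t * 2 ^ s) ^ t"
    using M by (intro power_mono) (auto simp: c_def)
  also have "\<dots> = c ^ t * (real s powr (2 - real s / real t)) ^ t * real t ^ t * 2 ^ (s * t)"
    by (simp add: power_mult_distrib power_mult)
  also have "(real s powr (2 - real s / real t)) ^ t = real s powr ((2 - real s / real t) * real t)"
    using s by (simp add: powr_realpow[symmetric] powr_powr)
  also have "(2 - real s / real t) * real t = real (2 * (t - s) + s)"
    using s assms(2) by (simp add: field_simps)
  also have "real s powr \<dots> = (real s)\<^sup>2 ^ (t - s) * real s ^ s"
    using s by (simp only: powr_realpow power_add power_mult)
  finally have Mt: "M ^ t \<le> c ^ t * ((real s)\<^sup>2 ^ (t - s) * real s ^ s) * real t ^ t * 2 ^ (s * t)" .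
  \<comment> \<open>Rounding \<open>2 * M\<close> up to \<open>16 * M\<close> merges the two powers
    into a single power \<open>t\<close> of \<open>M\<close>.\<close>
  have "(2 * M) ^ s * (16 * M / (real s)\<^sup>2) ^ (t - s) \<le> (16 * M) ^ s * (16 * M / (real s)\<^sup>2) ^ (t - s)"
    using M by (intro mult_right_mono power_mono) auto
  also have "\<dots> = ((16 * M) ^ s * (16 * M) ^ (t - s)) / (real s)\<^sup>2 ^ (t - s)"
    by (simp only: power_divide times_divide_eq_right)
  also have "(16 * M) ^ s * (16 * M) ^ (t - s) = 16 ^ t * M ^ t"
    unfolding power_add[symmetric] using assms(2) by (simp add: power_mult_distrib)
  also have "16 ^ t * M ^ t / (real s)\<^sup>2 ^ (t - s)
      \<le> 16 ^ t * (c ^ t * ((real s)\<^sup>2 ^ (t - s) * real s ^ s) * real t ^ t * 2 ^ (s * t)) / (real s)\<^sup>2 ^ (t - s)"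
    using Mt by (intro divide_right_mono mult_left_mono) auto
  also have "\<dots> = (16 * c) ^ t * (real s ^ s * real t ^ t) * 2 ^ (s * t)"
    using s by (simp add: power_mult_distrib)
  also have "\<dots> \<le> (16 * c) ^ t * ((3 ^ s * fact s) * (3 ^ t * fact t)) * 2 ^ (s * t)"
    by (intro mult_right_mono mult_left_mono mult_mono power_self_le_fact) (auto simp: c_def)
  also have "\<dots> \<le> (16 * c) ^ t * ((3 ^ t * fact s) * (3 ^ t * fact t)) * 2 ^ (s * t)"
    using assms(2) by (intro mult_right_mono mult_left_mono power_increasing) (auto simp: c_def)
  also have "\<dots> = (144 * c) ^ t * (fact s * fact t) * 2 ^ (s * t)"
  proof -
    have "(16 * c) ^ t * (3 ^ t * 3 ^ t) = (144 * c) ^ t" by (simp only: power_mult_distrib[symmetric]) simp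
    then have "(144 * c) ^ t * (fact s * fact t) * 2 ^ (s * t)
        = (16 * c) ^ t * (3 ^ t * 3 ^ t) * (fact s * fact t) * 2 ^ (s * t)" by (simp only:)
    then show ?thesis by (simp only: mult_ac)
  qed
  finally have "(1/2) ^ (s * t) * ((2 * M) ^ s * (16 * M / (real s)\<^sup>2) ^ (t - s))
      \<le> (1/2) ^ (s * t) * ((144 * c) ^ t * (fact s * fact t) * 2 ^ (s * t))"
    by (intro mult_left_mono) auto
  also have "\<dots> = (144 * c) ^ t * (fact s * fact t)" by (simp add: power_divide)
  also have "\<dots> \<le> (1/8) * (fact s * fact t)"
  proof (intro mult_right_mono)
    have "(144 * c) ^ t \<le> (144 * c) ^ 1"
      using assms by (intro power_decreasing) (auto simp: c_def power_divide)
    also have "\<dots> \<le> 1/8" by (simp add: c_def power_divide)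
    finally show "(144 * c) ^ t \<le> 1/8" .
  qed auto
  finally show ?thesis by (simp add: divide_le_eq)
qed

text \<open>One of the two factors \<open>s ^ k\<close> in \<open>(s\<^sup>2) ^ k\<close> is at most
  \<open>k ^ k\<close>, which the factorial absorbs up to \<open>3 ^ k\<close>.\<close>

lemma binomial_square_le:
  assumes "s \<le> k" shows "real (s\<^sup>2 choose k) \<le> (3 * real s) ^ k"
proof -
  have "real (s\<^sup>2 choose k) * fact k \<le> real (s\<^sup>2) ^ k"
    using binomial_fact_pow[of "s\<^sup>2" k] by (metis of_nat_fact of_nat_le_iff of_nat_mult of_nat_power)
  also have "\<dots> = real s ^ k * real s ^ k" by (simp add: power2_eq_square power_mult_distrib)
  also have "\<dots> \<le> real s ^ k * real k ^ k" using assms by (intro mult_left_mono power_mono) auto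
  also have "\<dots> \<le> real s ^ k * (3 ^ k * fact k)" by (intro mult_left_mono power_self_le_fact) auto
  also have "\<dots> = (3 * real s) ^ k * fact k" by (simp add: power_mult_distrib)
  finally show ?thesis by simp
qed

text \<open>A crude bound on \<open>M\<close> suffices:
  \<open>s\<^sup>2 * t * 2 ^ s \<le> t ^ 3 * 2 ^ t \<le> 8 ^ t\<close>. The two binomial
  coefficients cost \<open>(3 * s) ^ t\<close> each, and \<open>2 ^ (s * t)\<close> outweighs
  everything once \<open>s \<ge> 16\<close>.\<close>

lemma low_count_estimate:
  assumes "16 \<le> s" "s \<le> t" and M: "0 \<le> M" "M \<le> (1/2)^24 * real s powr (2 - real s / real t) * real t * 2 ^ s"
  shows "2 * M * (real (s\<^sup>2 choose s) * real (s\<^sup>2 choose t)) * (1/2) ^ (s * t) \<le> 1/8"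
proof -
  have "real s powr (2 - real s / real t) \<le> real s powr 2" using assms by (intro powr_mono) auto
  also have "\<dots> = real s ^ 2" using assms by (simp add: powr_realpow)
  finally have "real s powr (2 - real s / real t) \<le> real s ^ 2" .
  then have "real s powr (2 - real s / real t) * real t * 2 ^ s \<le> real t ^ 2 * real t * 2 ^ t"
    using assms by (intro mult_mono power_increasing) (auto elim: order.trans)
  also have "\<dots> = real (t ^ 3) * 2 ^ t" by (simp add: power2_eq_square power3_eq_cube)
  also have "\<dots> \<le> real (4 ^ t) * 2 ^ t"
    using cube_le_exp[of t] assms by (intro mult_right_mono) (simp_all only: of_nat_le_iff, auto)
  also have "\<dots> = 8 ^ t" by (simp add: power_mult_distrib[symmetric])
  finally have "(1/2)^24 * (real s powr (2 - real s / real t) * real t * 2 ^ s) \<le> (1/2)^24 * 8 ^ t"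
    by (intro mult_left_mono) auto
  then have "M \<le> (1/2)^24 * 8 ^ t" using M(2) by (simp only: mult.assoc)
  moreover have "real (s\<^sup>2 choose s) \<le> (3 * real s) ^ t"
    using binomial_square_le[of s s] assms power_increasing[of s t "3 * real s"] by simp
  moreover have "real (s\<^sup>2 choose t) \<le> (3 * real s) ^ t"
    using binomial_square_le[of s t] assms by simp
  ultimately have "2 * M * (real (s\<^sup>2 choose s) * real (s\<^sup>2 choose t)) * (1/2) ^ (s * t)
      \<le> 2 * ((1/2)^24 * 8 ^ t) * ((3 * real s) ^ t * (3 * real s) ^ t) * (1/2) ^ (s * t)"
    using M by (intro mult_right_mono mult_mono) auto
  also have "\<dots> = (1/2)^23 * (72 * (real s)\<^sup>2 / 2 ^ s) ^ t"
  proof -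
    have "8 ^ t * ((3 * real s) ^ t * (3 * real s) ^ t) * (1/2) ^ (s * t) = (72 * (real s)\<^sup>2 / 2 ^ s) ^ t"
      by (simp only: power_mult power_mult_distrib[symmetric]) (simp add: power_divide power2_eq_square)
    moreover have "2 * ((1/2)^24 * a) * b * d = (1/2)^23 * (a * b * d)" for a b d :: real
      by (simp add: power_divide)
    ultimately show ?thesis by (simp only:)
  qed
  also have "\<dots> \<le> (1/2)^23 * 1"
  proof (intro mult_left_mono power_le_one)
    have "real (72 * s\<^sup>2) \<le> real (2 ^ s)" using square_le_exp[OF assms(1)] of_nat_le_iff by blast
    then show "72 * (real s)\<^sup>2 / 2 ^ s \<le> 1" by simp
  qed auto
  also have "(1/2)^23 * 1 \<le> (1/8::real)" by (simp add: power_divide)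
  finally show ?thesis .
qed

subsection \<open>The lower bound\<close>

text \<open>The bicliques are split into \<open>A\<close>, where one side has no low vertex and the
  weights apply, and \<open>B\<close>, where both sides have one. Each class contributes at most
  1/8, so twice the total stays below 1.\<close>

lemma balanced_colouring_of_sparse_graph:
  assumes finV: "finite V" and E: "E \<subseteq> [V]\<^bsup>2\<^esup>" and s: "16 \<le> s" "s \<le> t"
    and m: "real (card E) \<le> (1/2)^24 * real s powr (2 - real s / real t) * real t * 2 ^ s"
  shows "\<exists>\<chi> :: 'a set \<Rightarrow> bool. \<forall>(S, T)\<in>bicliques E s t. \<not> (\<exists>b. \<forall>e\<in>edges_between S T. \<chi> e = b)"
proof -
  define M where "M = real (card E)"
  define L where "L = {v. card (neighbours E v) < s\<^sup>2}"
  define w where "w = (\<lambda>v. min 1 (8 * real (card (neighbours E v)) / (real s)\<^sup>2))"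
  define q where "q = (\<lambda>(S, T). mono_bound E (edge_block L) (edges_between S T))"
  define A where "A = {(S, T)\<in>bicliques E s t. S \<inter> L = {} \<or> T \<inter> L = {}}"
  define B where "B = {(S, T)\<in>bicliques E s t. S \<inter> L \<noteq> {} \<and> T \<inter> L \<noteq> {}}"
  have s1: "1 \<le> s" "2 \<le> s" "1 \<le> t" using s by auto
  have M: "0 \<le> M" "M \<le> (1/2)^24 * real s powr (2 - real s / real t) * real t * 2 ^ s"
    using m by (auto simp: M_def)
  have arcs: "real (card (arcs E)) \<le> 2 * M"
    using card_arcs_le[OF finV E] by (simp add: M_def)
  have AB: "bicliques E s t = A \<union> B" "A \<inter> B = {}" by (auto simp: A_def B_def)
  have "bicliques E s t \<subseteq> Pow V \<times> Pow V"
    using bicliques_subset(1,2)[OF finV E _ s1(1,3)] by (intro subrelI) simp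
  then have fin: "finite (bicliques E s t)" using finV finite_subset by blast
  have w: "0 \<le> w v" "w v \<le> 1" for v by (auto simp: w_def)
  have "(\<Sum>p\<in>A. q p) \<le> (\<Sum>(S, T)\<in>A. (1/2) ^ (s * t) * (\<Prod>v\<in>T. w v))"
  proof (rule sum_mono, clarify)
    fix S T assume "(S, T) \<in> A"
    then show "q (S, T) \<le> (1/2) ^ (s * t) * (\<Prod>v\<in>T. w v)"
      using mono_bound_edges_between_le[OF finV E _ s1(2,3) L_def, of S T]
      by (simp add: A_def q_def w_def)
  qed
  also have "\<dots> = (1/2) ^ (s * t) * (\<Sum>(S, T)\<in>A. \<Prod>v\<in>T. w v)"
    by (simp add: sum_distrib_left case_prod_unfold)
  also have "\<dots> = (1/2) ^ (s * t) * (fact s * fact t * (\<Sum>(S, T)\<in>A. \<Prod>v\<in>T. w v)) / (fact s * fact t)"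
    by simp
  also have "\<dots> \<le> (1/2) ^ (s * t) * ((2 * M) ^ s * (16 * M / (real s)\<^sup>2) ^ (t - s)) / (fact s * fact t)"
  proof (intro divide_right_mono mult_left_mono)
    \<comment> \<open>Dropping the minimum leaves 8 / s^2 times the degree sum, which is at most
      \<open>2 * M\<close>; hence the constant 16.\<close>
    have "(\<Sum>v\<in>V. w v) \<le> (\<Sum>v\<in>V. 8 * real (card (neighbours E v)) / (real s)\<^sup>2)"
      by (rule sum_mono) (simp add: w_def)
    also have "\<dots> = 8 * real (card (arcs E)) / (real s)\<^sup>2"
      unfolding sum_degrees[OF finV E, symmetric]
      by (simp add: sum_divide_distrib[symmetric] sum_distrib_left[symmetric])
    also have "\<dots> \<le> 16 * M / (real s)\<^sup>2"
      using arcs by (intro divide_right_mono) auto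
    finally have W: "(\<Sum>v\<in>V. w v) \<le> 16 * M / (real s)\<^sup>2" .
    have "fact s * fact t * (\<Sum>(S, T)\<in>A. \<Prod>v\<in>T. w v)
        \<le> real (card (arcs E)) ^ s * (\<Sum>v\<in>V. w v) ^ (t - s)"
    proof (rule weighted_bipartite_count[OF finV s(2) w arcs_subset[OF finV E]])
      fix S T assume "(S, T) \<in> A"
      then have "(S, T) \<in> bicliques E s t" by (simp add: A_def)
      then show "S \<times> T \<subseteq> arcs E \<and> finite S \<and> T \<subseteq> V \<and> card S = s \<and> card T = t"
        using bicliques_subset[OF finV E _ s1(1,3)] by (simp add: bicliques_def)
    qed
    also have "\<dots> \<le> (2 * M) ^ s * (16 * M / (real s)\<^sup>2) ^ (t - s)"
      using arcs W M w by (intro mult_mono power_mono) (auto intro!: zero_le_power sum_nonneg)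
    finally show "fact s * fact t * (\<Sum>(S, T)\<in>A. \<Prod>v\<in>T. w v)
        \<le> (2 * M) ^ s * (16 * M / (real s)\<^sup>2) ^ (t - s)" .
  qed auto
  also have "\<dots> \<le> 1/8" by (rule weighted_count_estimate[OF s1(1) s(2) M])
  finally have sumA: "(\<Sum>p\<in>A. q p) \<le> 1/8" .
  \<comment> \<open>For these few bicliques no saving from balance is used.\<close>
  have "(\<Sum>p\<in>B. q p) \<le> (\<Sum>p\<in>B. (1/2) ^ (s * t))"
  proof (rule sum_mono, clarify)
    fix S T assume "(S, T) \<in> B"
    then have "(S, T) \<in> bicliques E s t" by (simp add: B_def)
    then show "q (S, T) \<le> (1/2) ^ (s * t)"
      using mono_bound_le[OF finite_E[OF finV E], of "{}" "edge_block L" 0 "edges_between S T"]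
        card_edges_between[OF finV E _ s1(1,3)] by (simp add: q_def)
  qed
  also have "\<dots> = real (card B) * (1/2) ^ (s * t)" by simp
  also have "\<dots> \<le> 2 * M * (real (s\<^sup>2 choose s) * real (s\<^sup>2 choose t)) * (1/2) ^ (s * t)"
  proof (rule mult_right_mono)
    have "real (card B) \<le> real (card (arcs E)) * (real (s\<^sup>2 choose s) * real (s\<^sup>2 choose t))"
      using card_low_bicliques_le[OF finV E L_def, of t] unfolding B_def
      by (simp only: of_nat_mult[symmetric] of_nat_le_iff)
    also have "\<dots> \<le> 2 * M * (real (s\<^sup>2 choose s) * real (s\<^sup>2 choose t))"
      using arcs by (intro mult_right_mono) auto
    finally show "real (card B) \<le> 2 * M * (real (s\<^sup>2 choose s) * real (s\<^sup>2 choose t))" .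
  qed auto
  also have "\<dots> \<le> 1/8" by (rule low_count_estimate[OF s M])
  finally have sumB: "(\<Sum>p\<in>B. q p) \<le> 1/8" .
  have "(\<Sum>p\<in>bicliques E s t. q p) = (\<Sum>p\<in>A. q p) + (\<Sum>p\<in>B. q p)"
    using fin AB by (metis finite_Un sum.union_disjoint)
  then have "2 * (\<Sum>p\<in>bicliques E s t. q p) < 1" using sumA sumB by linarith
  then have "2 * (\<Sum>p\<in>bicliques E s t. mono_bound E (edge_block L) (edges_between (fst p) (snd p))) < 1"
    by (simp add: q_def case_prod_unfold)
  moreover have "edges_between (fst p) (snd p) \<subseteq> E" if "p \<in> bicliques E s t" for p
    using that by (intro edges_between_subset) simp
  ultimately have "\<exists>\<chi> :: 'a set \<Rightarrow> bool. \<forall>p\<in>bicliques E s t.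
      \<not> (\<exists>b. \<forall>e\<in>edges_between (fst p) (snd p). \<chi> e = b)"
    by (intro balanced_colouring_exists[OF finite_E[OF finV E] fin])
  then show ?thesis by (simp add: case_prod_unfold)
qed

text \<open>For \<open>s \<ge> 16\<close> a Ramsey graph with too few edges would contradict the
  balanced colouring. For smaller \<open>s\<close> it is enough that a Ramsey graph contains a copy,
  and hence at least \<open>t\<close> edges.\<close>

lemma size_ramsey_ge:
  assumes s: "1 \<le> s" "s \<le> t"
  shows "(1/2)^24 * real s powr (2 - real s / real t) * real t * 2 ^ s
    \<le> real (size_ramsey (complete_bipartite s t))"
proof -
  let ?B = "complete_bipartite s t"
  let ?Y = "(1/2)^24 * real s powr (2 - real s / real t) * real t * 2 ^ s"
  have "\<exists>G :: nat graph. fin_simple_graph G \<and> ramsey_for G ?B \<and> card (edges G) = size_ramsey ?B"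
    unfolding size_ramsey_def by (rule LeastI_ex) (use ramsey_graph_exists in blast)
  then obtain G :: "nat graph" where G: "fin_simple_graph G" "ramsey_for G ?B"
    and m: "card (edges G) = size_ramsey ?B" by blast
  have V: "finite (verts G)" and E: "edges G \<subseteq> [verts G]\<^bsup>2\<^esup>"
    using G by (auto simp: fin_simple_graph_def)
  have mono: "\<exists>S T b. (S, T) \<in> bicliques (edges G) s t \<and> (\<forall>e\<in>edges_between S T. \<chi> e = b)"
    for \<chi> :: "nat set \<Rightarrow> bool"
  proof -
    obtain K b where K: "is_copy_in K ?B G" "\<forall>e\<in>edges K. \<chi> e = b"
      using G(2) unfolding ramsey_for_def by blast
    obtain S T where ST: "(S, T) \<in> bicliques (edges K) s t"
      using copy_of_complete_bipartite[OF K(1)] by blast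
    have "edges K \<subseteq> edges G" using K(1) by (simp add: is_copy_in_def subgraph_def)
    from subsetD[OF bicliques_mono[OF this] ST] have "(S, T) \<in> bicliques (edges G) s t" .
    moreover have "\<forall>e\<in>edges_between S T. \<chi> e = b" using edges_between_subset[OF ST] K(2) by blast
    ultimately show ?thesis by blast
  qed
  show ?thesis
  proof (cases "16 \<le> s")
    case True
    show ?thesis
    proof (rule ccontr)
      assume "\<not> ?thesis"
      then have "real (card (edges G)) \<le> ?Y" by (simp add: m)
      from balanced_colouring_of_sparse_graph[OF V E True s(2) this] obtain \<chi> :: "nat set \<Rightarrow> bool" where \<chi>:
        "\<forall>(S, T)\<in>bicliques (edges G) s t. \<not> (\<exists>b. \<forall>e\<in>edges_between S T. \<chi> e = b)" by (elim exE)
      obtain S T b where ST: "(S, T) \<in> bicliques (edges G) s t"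
        and b: "\<forall>e\<in>edges_between S T. \<chi> e = b"
        using mono by blast
      have "\<not> (\<exists>b. \<forall>e\<in>edges_between S T. \<chi> e = b)"
        using bspec[OF \<chi> ST] unfolding case_prod_conv .
      then show False using exI[of "\<lambda>b. \<forall>e\<in>edges_between S T. \<chi> e = b", OF b] by (rule notE)
    qed
  next
    case False
    obtain S T where ST: "(S, T) \<in> bicliques (edges G) s t" using mono by blast
    have "s * t = card (edges_between S T)"
      using card_edges_between[OF V E ST] s by simp
    also have "\<dots> \<le> card (edges G)"
      using edges_between_subset[OF ST] finite_E[OF V E] by (rule card_mono[rotated])
    finally have "1 * t \<le> card (edges G)" using s by (meson le_trans mult_le_mono1)
    then have t: "real t \<le> real (size_ramsey ?B)" by (simp add: m)
    \<comment> \<open>This case fixes the constant: the factors depending on \<open>s\<close> are at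
      most 16^2 * 2^16 = 2^24.\<close>
    have "real s powr (2 - real s / real t) \<le> real s powr 2" using s by (intro powr_mono) auto
    also have "\<dots> = real s ^ 2" using s by (simp add: powr_realpow)
    also have "\<dots> \<le> 16 ^ 2" using False by (intro power_mono) auto
    finally have "real s powr (2 - real s / real t) \<le> 16 ^ 2" .
    moreover have "(2::real) ^ s \<le> 2 ^ 16" using False by (intro power_increasing) auto
    ultimately have "?Y \<le> (1/2)^24 * 16 ^ 2 * real t * 2 ^ 16"
      by (intro mult_mono order_refl) auto
    also have "\<dots> = real t" by (simp add: power_divide)
    finally show ?thesis using t by simp
  qed
qed

theorem theorem1p1:
  "\<exists>c::real. c > 0 \<and>
     (\<forall>s t :: nat. 1 \<le> s \<and> s \<le> t \<longrightarrow>
        real (size_ramsey (complete_bipartite s t))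
          \<ge> c * real s powr (2 - real s / real t) * real t * 2 ^ s)"
  using size_ramsey_ge by (intro exI[of _ "(1/2)^24"]) auto

end
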